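(* Let $((x^k,y^k))_{k\ge0}$ and $(z^j)_{j\ge0}$ be generated by relaxed ADMM (described in the context) with $(\lambda_j)_{j\ge0}\subseteq(0,1]$ and $\gamma>0$, and let $z^\ast$ be a fixed point of $T_{\mathrm{PRS}}=\mathbf{refl}_{\gamma d_f}\circ\mathbf{refl}_{\gamma d_g}$. Then: 1. (Ergodic convergence) For all $k\ge0$, $$\|A\overline{x}^k+B\overline{y}^k-b\|^2\le\frac{4\|z^0-z^\ast\|^2}{\gamma^2\Lambda_k^2}.$$ 2. (Nonergodic convergence) Suppose that $\underline{\tau}=\inf_{j\ge0}\lambda_j(1-\lambda_j)>0$. Then for all $k\ge0$ $$\|Ax^k+By^k-b\|^2\le\frac{\|z^0-z^\ast\|^2}{4\gamma^2\underline{\tau}(k+1)}\quad\text{and}\quad\|Ax^k+By^k-b\|^2=o\left(\frac{1}{k+1}\right).$$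
   Context: Setting: $\mathcal{H}_1,\mathcal{H}_2,\mathcal{G}$ are Hilbert spaces, $f:\mathcal{H}_1\to(-\infty,\infty]$ and $g:\mathcal{H}_2\to(-\infty,\infty]$ are closed, proper, convex, $A:\mathcal{H}_1\to\mathcal{G}$ and $B:\mathcal{H}_2\to\mathcal{G}$ are bounded linear, $b\in\mathcal{G}$; the problem is to minimize $f(x)+g(y)$ subject to $Ax+By=b$. Put $d_f(w):=f^\ast(A^\ast w)$ and $d_g(w):=g^\ast(B^\ast w)-\langle w,b\rangle$ on $\mathcal{G}$, where $f^\ast,g^\ast$ are convex conjugates and $A^\ast,B^\ast$ adjoints. Standing assumptions: $\operatorname{zer}(\partial d_f+\partial d_g)\ne\emptyset$, $\partial d_f=A\circ\partial f^\ast\circ A^\ast$, and $\partial d_g=B\circ\partial g^\ast\circ B^\ast-b$. $\mathbf{prox}_{\gamma h}(w):=\arg\min_vh(v)+\frac1{2\gamma}\|v-w\|^2$, $\mathbf{refl}_{\gamma h}:=2\mathbf{prox}_{\gamma h}-I$. Relaxed ADMM: with $\mathcal{L}_\gamma(x,y;w):=f(x)+g(y)-\langle w,Ax+By-b\rangle+\frac\gamma2\|Ax+By-b\|^2$, start from $w^{-1}\in\mathcal{G}$, $x^{-1}=0$, $y^{-1}=0$, $\lambda_{-1}=1/2$, and for $k=-1,0,1,\dots$ let $y^{k+1}\in\arg\min_y\mathcal{L}_\gamma(x^k,y;w^k)+\gamma(2\lambda_k-1)\langle By,Ax^k+By^k-b\rangle$; $w^{k+1}=w^k-\gamma(Ax^k+By^{k+1}-b)-\gamma(2\lambda_k-1)(Ax^k+By^k-b)$;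 $x^{k+1}\in\arg\min_x\mathcal{L}_\gamma(x,y^{k+1};w^{k+1})$. The associated sequence $(z^j)_{j\ge0}\subseteq\mathcal{G}$ is the relaxed Peaceman-Rachford sequence on the dual: $z^0:=w^{-1}$ and $z^{k+1}=(1-\lambda_k)z^k+\lambda_kT_{\mathrm{PRS}}(z^k)$; it satisfies $z^{k+1}-z^k=-2\gamma\lambda_k(Ax^k+By^k-b)$. $\Lambda_k:=\sum_{i=0}^k\lambda_i$, $\overline{x}^k:=\frac{1}{\Lambda_k}\sum_{i=0}^k\lambda_ix^i$, $\overline{y}^k:=\frac1{\Lambda_k}\sum_{i=0}^k\lambda_iy^i$. *)

theory Defs
  imports "HOL-Analysis.Analysis" "HOL-Library.Landau_Symbols"
begin

text \<open>
  Hilbert spaces are real and are rendered by the sort \<open>{real_inner, complete_space}\<close>.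
  Functions into \<open>(-\<infinity>, \<infinity>]\<close> are \<open>ereal\<close>-valued; properness excludes the value \<open>-\<infinity>\<close>.
\<close>

definition ereal_epigraph :: "('a \<Rightarrow> ereal) \<Rightarrow> ('a \<times> real) set" where
  "ereal_epigraph f = {(x, r). f x \<le> ereal r}"

definition closed_proper_convex :: "('a::real_normed_vector \<Rightarrow> ereal) \<Rightarrow> bool" where
  "closed_proper_convex f \<longleftrightarrow>
     closed (ereal_epigraph f) \<and> convex (ereal_epigraph f) \<and>
     (\<forall>x. f x \<noteq> -\<infinity>) \<and> (\<exists>x. f x \<noteq> \<infinity>)"

definition fenchel_conjugate :: "('a::real_inner \<Rightarrow> ereal) \<Rightarrow> 'a \<Rightarrow> ereal" where
  "fenchel_conjugate f u = (SUP x. ereal (u \<bullet> x) - f x)"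

text \<open>The usual convention that the subdifferential is empty outside the effective domain.\<close>

definition subdifferential :: "('a::real_inner \<Rightarrow> ereal) \<Rightarrow> 'a \<Rightarrow> 'a set" where
  "subdifferential f x =
     (if \<bar>f x\<bar> = \<infinity> then {} else {u. \<forall>y. f x + ereal (u \<bullet> (y - x)) \<le> f y})"

definition zer :: "('a \<Rightarrow> 'b::zero set) \<Rightarrow> 'a set" where
  "zer T = {x. 0 \<in> T x}"

text \<open>
  For a closed proper convex function and \<open>\<gamma> > 0\<close> the minimizer exists and is unique, so the
  choice made by \<^const>\<open>arg_min\<close> is immaterial.
\<close>

definition prox :: "real \<Rightarrow> ('a::real_inner \<Rightarrow> ereal) \<Rightarrow> 'a \<Rightarrow> 'a" where
  "prox \<gamma> h w = arg_min (\<lambda>v. h v + ereal (1 / (2 * \<gamma>) * (norm (v - w))\<^sup>2)) (\<lambda>_. True)"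

definition reflected_prox :: "real \<Rightarrow> ('a::real_inner \<Rightarrow> ereal) \<Rightarrow> 'a \<Rightarrow> 'a" where
  "reflected_prox \<gamma> h w = 2 *\<^sub>R prox \<gamma> h w - w"

definition dual_f :: "('a::real_inner \<Rightarrow> ereal) \<Rightarrow> ('a \<Rightarrow> 'g::real_inner) \<Rightarrow> 'g \<Rightarrow> ereal" where
  "dual_f f A w = fenchel_conjugate f (adjoint A w)"

definition dual_g ::
  "('c::real_inner \<Rightarrow> ereal) \<Rightarrow> ('c \<Rightarrow> 'g::real_inner) \<Rightarrow> 'g \<Rightarrow> 'g \<Rightarrow> ereal" where
  "dual_g g B b w = fenchel_conjugate g (adjoint B w) - ereal (w \<bullet> b)"

definition T_PRS ::
  "real \<Rightarrow> ('g::real_inner \<Rightarrow> ereal) \<Rightarrow> ('g \<Rightarrow> ereal) \<Rightarrow> 'g \<Rightarrow> 'g" where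
  "T_PRS \<gamma> df dg = reflected_prox \<gamma> df \<circ> reflected_prox \<gamma> dg"

definition aug_lagrangian ::
  "('a \<Rightarrow> ereal) \<Rightarrow> ('c \<Rightarrow> ereal) \<Rightarrow> ('a \<Rightarrow> 'g::real_inner) \<Rightarrow> ('c \<Rightarrow> 'g) \<Rightarrow> 'g \<Rightarrow> real
    \<Rightarrow> 'a \<Rightarrow> 'c \<Rightarrow> 'g \<Rightarrow> ereal" where
  "aug_lagrangian f g A B b \<gamma> x y w =
     f x + g y + ereal (- (w \<bullet> (A x + B y - b)) + \<gamma> / 2 * (norm (A x + B y - b))\<^sup>2)"

text \<open>
  One iteration of relaxed ADMM with relaxation parameter \<open>l\<close>, leading from \<open>(x, y, w)\<close> to
  \<open>(x', y', w')\<close>. In the \<open>y\<close>-subproblem the summand \<open>f x\<close> of the Lagrangian does not depend on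
  the minimization variable and is replaced by \<open>0\<close>. Where \<open>f x\<close> is finite this does not change
  the minimizers; but the algorithm is started at \<open>x = 0\<close>, where \<open>f\<close> may be infinite, and keeping
  the summand there would make the objective identically \<open>\<infinity>\<close>, hence every point a minimizer.
\<close>

definition relaxed_admm_step ::
  "('a::real_inner \<Rightarrow> ereal) \<Rightarrow> ('c::real_inner \<Rightarrow> ereal) \<Rightarrow> ('a \<Rightarrow> 'g::real_inner) \<Rightarrow> ('c \<Rightarrow> 'g)
    \<Rightarrow> 'g \<Rightarrow> real \<Rightarrow> real \<Rightarrow> 'a \<times> 'c \<times> 'g \<Rightarrow> 'a \<times> 'c \<times> 'g \<Rightarrow> bool" where
  "relaxed_admm_step f g A B b \<gamma> l = (\<lambda>(x, y, w) (x', y', w').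
     is_arg_min (\<lambda>v. aug_lagrangian (\<lambda>_. 0) g A B b \<gamma> x v w
                     + ereal (\<gamma> * (2 * l - 1) * (B v \<bullet> (A x + B y - b)))) (\<lambda>_. True) y' \<and>
     w' = w - \<gamma> *\<^sub>R (A x + B y' - b) - (\<gamma> * (2 * l - 1)) *\<^sub>R (A x + B y - b) \<and>
     is_arg_min (\<lambda>u. aug_lagrangian f g A B b \<gamma> u y' w') (\<lambda>_. True) x')"

text \<open>
  The iteration starts at index \<open>-1\<close> with \<open>(x, y, w) = (0, 0, w_init)\<close> and relaxation parameter
  \<open>1/2\<close>; this first step, which produces the iterates of index \<open>0\<close>, is stated separately so
  that all sequences are indexed by \<^typ>\<open>nat\<close>.
\<close>

definition relaxed_admm ::
  "('a::real_inner \<Rightarrow> ereal) \<Rightarrow> ('c::real_inner \<Rightarrow> ereal) \<Rightarrow> ('a \<Rightarrow> 'g::real_inner) \<Rightarrow> ('c \<Rightarrow> 'g)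
    \<Rightarrow> 'g \<Rightarrow> real \<Rightarrow> (nat \<Rightarrow> real) \<Rightarrow> 'g \<Rightarrow> (nat \<Rightarrow> 'a) \<Rightarrow> (nat \<Rightarrow> 'c) \<Rightarrow> (nat \<Rightarrow> 'g) \<Rightarrow> bool" where
  "relaxed_admm f g A B b \<gamma> lam w_init x y w \<longleftrightarrow>
     relaxed_admm_step f g A B b \<gamma> (1 / 2) (0, 0, w_init) (x 0, y 0, w 0) \<and>
     (\<forall>k. relaxed_admm_step f g A B b \<gamma> (lam k) (x k, y k, w k)
            (x (Suc k), y (Suc k), w (Suc k)))"

definition relaxed_PRS :: "('g::real_vector \<Rightarrow> 'g) \<Rightarrow> (nat \<Rightarrow> real) \<Rightarrow> 'g \<Rightarrow> (nat \<Rightarrow> 'g) \<Rightarrow> bool" where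
  "relaxed_PRS T lam z_init z \<longleftrightarrow>
     z 0 = z_init \<and> (\<forall>k. z (Suc k) = (1 - lam k) *\<^sub>R z k + lam k *\<^sub>R T (z k))"

definition weight_sum :: "(nat \<Rightarrow> real) \<Rightarrow> nat \<Rightarrow> real" where
  "weight_sum lam k = (\<Sum>i=0..k. lam i)"

definition ergodic_mean :: "(nat \<Rightarrow> real) \<Rightarrow> (nat \<Rightarrow> 'a::real_vector) \<Rightarrow> nat \<Rightarrow> 'a" where
  "ergodic_mean lam x k = (1 / weight_sum lam k) *\<^sub>R (\<Sum>i=0..k. lam i *\<^sub>R x i)"

end

theory Submission
  imports Defs
begin

text \<open>
  The optimality conditions of the two ADMM subproblems produce subgradients of the dual functions,
  \<open>B y\<^sup>k - b \<in> \<partial>d\<^sub>g(w\<^sup>k)\<close> and \<open>A x\<^sup>k \<in> \<partial>d\<^sub>f(w\<^sup>k - \<gamma> r\<^sup>k)\<close> with \<open>r\<^sup>k = A x\<^sup>k + B y\<^sup>k - b\<close>. They identify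
  \<open>z\<^sup>k = w\<^sup>k + \<gamma> (B y\<^sup>k - b)\<close> and \<open>T z\<^sup>k - z\<^sup>k = -2 \<gamma> r\<^sup>k\<close>. So the feasibility gap is the fixed-point
  residual of a relaxed iteration of the nonexpansive map \<open>T = T\<^sub>P\<^sub>R\<^sub>S\<close>. The ergodic bound follows by
  telescoping \<open>z\<^sup>k\<^sup>+\<^sup>1 - z\<^sup>k = -2 \<gamma> \<lambda>\<^sub>k r\<^sup>k\<close>; the nonergodic ones because the squared residuals are
  nonincreasing and, by Fejer monotonicity, summable.
\<close>

section \<open>First-order optimality and proximal points, stated on epigraphs\<close>

text \<open>Moving from \<open>(p, s)\<close> a fraction \<open>t\<close> towards
  \<open>(v, r)\<close> stays in \<open>E\<close>; dividing the minimality inequality by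
  \<open>t\<close> and letting \<open>t\<close> tend to 0 removes \<open>C\<close>. Only a quadratic
  upper expansion of \<open>q\<close> with slope \<open>D\<close> enters, so both the proximal
  penalty and the augmented Lagrangian fit.\<close>

lemma convex_first_order_optimality:
  fixes E :: "('a::real_normed_vector \<times> real) set" and q :: "'a \<Rightarrow> real"
  assumes E: "convex E" "(p, s) \<in> E" "(v, r) \<in> E"
    and min: "\<And>u t. (u, t) \<in> E \<Longrightarrow> s + q p \<le> t + q u"
    and q: "\<And>t. 0 < t \<Longrightarrow> t \<le> 1 \<Longrightarrow> q (p + t *\<^sub>R (v - p)) \<le> q p + t * D + t\<^sup>2 * C"
  shows "s \<le> r + D"
proof -
  have ineq: "0 \<le> r - s + D + t * C" if t: "0 < t" "t \<le> 1" for t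
  proof -
    have "(1 - t) *\<^sub>R (p, s) + t *\<^sub>R (v, r) \<in> E"
      using E t by (intro convexD) auto
    then have "(p + t *\<^sub>R (v - p), s + t * (r - s)) \<in> E"
      by (simp add: algebra_simps)
    from min[OF this] q[OF t] have "0 \<le> t * (r - s) + t * D + t\<^sup>2 * C"
      by linarith
    also have "\<dots> = t * (r - s + D + t * C)"
      by (simp add: algebra_simps power2_eq_square)
    finally show ?thesis
      using t by (simp add: zero_le_mult_iff)
  qed
  have "((\<lambda>t. r - s + D + t * C) \<longlongrightarrow> r - s + D + 0 * C) (at_right 0)"
    by (intro tendsto_intros)
  moreover have "eventually (\<lambda>t. 0 \<le> r - s + D + t * C) (at_right (0::real))"
    by (rule eventually_mono[OF eventually_at_right_real[of 0 1]]) (use ineq in auto)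
  ultimately have "0 \<le> r - s + D + 0 * C"
    by (intro tendsto_lowerbound[of _ _ "at_right (0::real)"]) auto
  then show ?thesis by simp
qed

text \<open>
  By the parallelogram law, minimizing sequences of the strongly convex function
  \<open>(v, r) \<mapsto> r + \<parallel>v - w\<parallel>\<^sup>2 / (2 \<gamma>)\<close> are Cauchy in the first component.
\<close>

lemma proximal_point_exists:
  fixes E :: "('a::{real_inner, complete_space} \<times> real) set"
  assumes E: "closed E" "convex E" "E \<noteq> {}" and "\<gamma> > 0"
    and bdd: "\<And>v r. (v, r) \<in> E \<Longrightarrow> m0 \<le> r + (norm (v - w))\<^sup>2 / (2 * \<gamma>)"
  obtains p s where "(p, s) \<in> E" "\<And>v r. (v, r) \<in> E \<Longrightarrow> s + ((w - p) \<bullet> (v - p)) / \<gamma> \<le> r"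
proof -
  define F where "F = (\<lambda>(v::'a, r). r + (norm (v - w))\<^sup>2 / (2 * \<gamma>))"
  define m where "m = Inf (F ` E)"
  have bddF: "bdd_below (F ` E)"
    using bdd by (auto simp: F_def intro!: bdd_belowI[of _ m0])
  have m_le: "m \<le> F e" if "e \<in> E" for e
    unfolding m_def using bddF that by (intro cInf_lower) auto
  have "\<exists>e\<in>E. F e < m + 1 / real (Suc n)" for n
    using cInf_less_iff[of "F ` E" "m + 1 / real (Suc n)"] E(3) bddF by (auto simp: m_def)
  then obtain e where e: "\<And>n. e n \<in> E" "\<And>n. F (e n) < m + 1 / real (Suc n)"
    by metis
  define V R where "V = (\<lambda>n. fst (e n))" and "R = (\<lambda>n. snd (e n))"
  have inE: "(V n, R n) \<in> E" for n
    using e(1)[of n] by (simp add: V_def R_def)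
  have VR: "F (V n, R n) < m + 1 / real (Suc n)" for n
    using e(2)[of n] by (simp add: V_def R_def)
  have gap: "(norm (V n - V k))\<^sup>2 \<le> 4 * \<gamma> * (1 / real (Suc n) + 1 / real (Suc k))" for n k
  proof -
    have "(1/2) *\<^sub>R (V n, R n) + (1/2) *\<^sub>R (V k, R k) \<in> E"
      using inE E(2) by (intro convexD) auto
    from m_le[OF this]
    have mid: "m \<le> (R n + R k) / 2 + (norm ((1/2) *\<^sub>R V n + (1/2) *\<^sub>R V k - w))\<^sup>2 / (2 * \<gamma>)"
      by (simp add: F_def add_divide_distrib)
    have par: "(norm ((1/2) *\<^sub>R V n + (1/2) *\<^sub>R V k - w))\<^sup>2
        = (norm (V n - w))\<^sup>2 / 2 + (norm (V k - w))\<^sup>2 / 2 - (norm (V n - V k))\<^sup>2 / 4"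
      by (simp add: power2_norm_eq_inner algebra_simps inner_commute) (simp add: field_simps)
    have "(norm (V n - V k))\<^sup>2 / 4 / (2 * \<gamma>) \<le> F (V n, R n) / 2 + F (V k, R k) / 2 - m"
      using mid unfolding par F_def by (simp add: add_divide_distrib diff_divide_distrib)
    also have "\<dots> \<le> (1 / real (Suc n) + 1 / real (Suc k)) / 2"
    proof -
      have "r / 2 + r' / 2 - m \<le> (i + j) / 2" if "r < m + i" "r' < m + j" for r r' i j :: real
        using that by (simp add: field_simps)
      from this[OF VR VR] show ?thesis .
    qed
    finally show ?thesis
      using \<open>\<gamma> > 0\<close> by (simp add: divide_le_eq mult.commute mult.left_commute)
  qed
  have "Cauchy V"
  proof (rule metric_CauchyI)
    fix \<epsilon> :: real assume "\<epsilon> > 0"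
    then obtain M where M: "inverse (real (Suc M)) < \<epsilon>\<^sup>2 / (8 * \<gamma>)"
      using reals_Archimedean[of "\<epsilon>\<^sup>2 / (8 * \<gamma>)"] \<open>\<gamma> > 0\<close> by auto
    show "\<exists>M. \<forall>n\<ge>M. \<forall>k\<ge>M. dist (V n) (V k) < \<epsilon>"
    proof (intro exI allI impI)
      fix n k assume nk: "n \<ge> M" "k \<ge> M"
      have "1 / real (Suc n) \<le> 1 / real (Suc M)" "1 / real (Suc k) \<le> 1 / real (Suc M)"
        using nk by (auto intro!: divide_left_mono)
      then have "4 * \<gamma> * (1 / real (Suc n) + 1 / real (Suc k)) \<le> 4 * \<gamma> * (2 * inverse (real (Suc M)))"
        using \<open>\<gamma> > 0\<close> by (intro mult_left_mono) (auto simp: inverse_eq_divide)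
      also have "\<dots> < \<epsilon>\<^sup>2"
        using M \<open>\<gamma> > 0\<close> by (simp add: field_simps)
      finally have "(norm (V n - V k))\<^sup>2 < \<epsilon>\<^sup>2"
        using gap[of n k] by linarith
      then show "dist (V n) (V k) < \<epsilon>"
        using \<open>\<epsilon> > 0\<close> by (simp add: dist_norm power_less_imp_less_base)
    qed
  qed
  then obtain p where p: "V \<longlonglongrightarrow> p"
    using Cauchy_convergent convergent_def by blast
  \<comment> \<open>The only possible limit of \<open>R\<close>: it gives
    \<open>F (p, s) = m\<close>.\<close>
  define s where "s = m - (norm (p - w))\<^sup>2 / (2 * \<gamma>)"
  have "(\<lambda>n. F (V n, R n)) \<longlonglongrightarrow> m"
  proof (rule tendsto_sandwich[OF _ _ tendsto_const])
    show "(\<lambda>n. m + 1 / real (Suc n)) \<longlonglongrightarrow> m"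
      using tendsto_add[OF tendsto_const LIMSEQ_Suc[OF lim_1_over_n]] by simp
    show "\<forall>\<^sub>F n in sequentially. m \<le> F (V n, R n)"
      using m_le inE by simp
    show "\<forall>\<^sub>F n in sequentially. F (V n, R n) \<le> m + 1 / real (Suc n)"
      using VR by (intro always_eventually allI less_imp_le)
  qed
  then have "(\<lambda>n. F (V n, R n) - (norm (V n - w))\<^sup>2 / (2 * \<gamma>)) \<longlonglongrightarrow> s"
    unfolding s_def using \<open>\<gamma> > 0\<close> by (intro tendsto_intros p) auto
  then have "R \<longlonglongrightarrow> s"
    by (simp add: F_def)
  then have "(\<lambda>n. (V n, R n)) \<longlonglongrightarrow> (p, s)"
    by (rule tendsto_Pair[OF p])
  then have psE: "(p, s) \<in> E"
    using closed_sequentially[OF E(1), of "\<lambda>n. (V n, R n)"] inE by simp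
  have min: "s + (norm (p - w))\<^sup>2 / (2 * \<gamma>) \<le> t + (norm (u - w))\<^sup>2 / (2 * \<gamma>)" if "(u, t) \<in> E" for u t
    using m_le[OF that] by (simp add: F_def s_def)
  have "s + ((w - p) \<bullet> (v - p)) / \<gamma> \<le> r" if "(v, r) \<in> E" for v r
  proof -
    have "s \<le> r + - ((w - p) \<bullet> (v - p)) / \<gamma>"
    proof (rule convex_first_order_optimality[OF E(2) psE that, where q = "\<lambda>u. (norm (u - w))\<^sup>2 / (2 * \<gamma>)",
          OF min])
      fix t :: real
      have "(norm (p + t *\<^sub>R (v - p) - w))\<^sup>2
          = (norm (p - w))\<^sup>2 - 2 * t * ((w - p) \<bullet> (v - p)) + t\<^sup>2 * (norm (v - p))\<^sup>2"
        unfolding power2_norm_eq_inner by (simp add: algebra_simps inner_commute power2_eq_square)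
      then show "(norm (p + t *\<^sub>R (v - p) - w))\<^sup>2 / (2 * \<gamma>) \<le> (norm (p - w))\<^sup>2 / (2 * \<gamma>)
          + t * (- ((w - p) \<bullet> (v - p)) / \<gamma>) + t\<^sup>2 * ((norm (v - p))\<^sup>2 / (2 * \<gamma>))"
        using \<open>\<gamma> > 0\<close> by (simp add: field_simps)
    qed
    then show ?thesis by simp
  qed
  with psE show ?thesis by (rule that)
qed

section \<open>Adjoints in Hilbert space\<close>

text \<open>The representer is the minimizer of \<open>(norm v)\<^sup>2 / 2 - \<phi> v\<close>, that
  is, the proximal point of 0 for the epigraph of \<open>- \<phi>\<close>. Its variational
  inequality gives \<open>\<phi> u \<le> u \<bullet> p\<close>, and \<open>- u\<close> gives the
  converse.\<close>

lemma riesz_representation: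
  fixes \<phi> :: "'a::{real_inner, complete_space} \<Rightarrow> real"
  assumes "bounded_linear \<phi>"
  shows "\<exists>p. \<forall>v. \<phi> v = v \<bullet> p"
proof -
  interpret \<phi>: bounded_linear \<phi> by fact
  obtain K where K: "\<And>v. norm (\<phi> v) \<le> norm v * K"
    using \<phi>.bounded by blast
  let ?E = "{(v, r). - \<phi> v \<le> r}"
  have closed: "closed ?E"
    unfolding case_prod_beta
    by (intro closed_Collect_le continuous_intros \<phi>.continuous_on)
  have convex: "convex ?E"
  proof (rule convexI)
    fix e e' and i j :: real
    assume e: "e \<in> ?E" "e' \<in> ?E" and "0 \<le> i" "0 \<le> j"
    then have "i * (- \<phi> (fst e)) + j * (- \<phi> (fst e')) \<le> i * snd e + j * snd e'"
      by (intro add_mono mult_left_mono) auto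
    then show "i *\<^sub>R e + j *\<^sub>R e' \<in> ?E"
      by (simp add: case_prod_beta \<phi>.add \<phi>.scaleR)
  qed
  have nonempty: "?E \<noteq> {}" by blast
  have bdd: "- K\<^sup>2 / 2 \<le> r + (norm (v - 0))\<^sup>2 / (2 * 1)" if "(v, r) \<in> ?E" for v r
  proof -
    have "- (norm v * K) \<le> r"
      using that K[of v] by (simp add: abs_le_iff)
    moreover have "0 \<le> (norm v - K)\<^sup>2" by simp
    ultimately show ?thesis
      by (simp add: power2_diff)
  qed
  obtain p s where p: "(p, s) \<in> ?E"
    and opt: "\<And>v r. (v, r) \<in> ?E \<Longrightarrow> s + ((0 - p) \<bullet> (v - p)) / 1 \<le> r"
    using proximal_point_exists[OF closed convex nonempty zero_less_one bdd] by metis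
  have le: "\<phi> u \<le> u \<bullet> p" for u
    using p opt[of "p + u" "- \<phi> (p + u)"] by (simp add: \<phi>.add inner_commute)
  have "\<phi> u = u \<bullet> p" for u
    using le[of u] le[of "- u"] by (simp add: \<phi>.neg)
  then show ?thesis by blast
qed

text \<open>\<open>adjoint\<close> is a Hilbert choice, so its defining identity holds only once
  some adjoint is known to exist; Riesz representation supplies one pointwise.\<close>

lemma adjoint_inner:
  fixes L :: "'c::{real_inner, complete_space} \<Rightarrow> 'g::real_inner"
  assumes "bounded_linear L"
  shows "adjoint L w \<bullet> v = w \<bullet> L v"
proof -
  have "\<exists>p. \<forall>v. L v \<bullet> u = v \<bullet> p" for u
    by (rule riesz_representation) (intro bounded_linear_intros assms)
  then obtain L' where "\<forall>v u. L v \<bullet> u = v \<bullet> L' u"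
    by metis
  then have "\<forall>v u. L v \<bullet> u = v \<bullet> adjoint L u"
    unfolding adjoint_def by (rule someI[where P = "\<lambda>f'. \<forall>v u. L v \<bullet> u = v \<bullet> f' u"])
  then show ?thesis
    by (metis inner_commute)
qed

section \<open>The dual functions as suprema of affine functions\<close>

text \<open>Lets every fact about \<open>dual_g\<close> serve both duals.\<close>

lemma dual_f_eq_dual_g: "dual_f f A = dual_g f A 0"
  by (simp add: fun_eq_iff dual_f_def dual_g_def)

lemma dual_g_eq_SUP:
  fixes L :: "'c::{real_inner, complete_space} \<Rightarrow> 'g::real_inner"
  assumes "bounded_linear L"
  shows "dual_g h L b w = (SUP v. ereal (w \<bullet> (L v - b)) - h v)"
proof -
  have "dual_g h L b w = (SUP v. ereal (w \<bullet> L v) - h v) + ereal (- (w \<bullet> b))"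
    by (simp add: dual_g_def fenchel_conjugate_def adjoint_inner[OF assms] minus_ereal_def)
  also have "\<dots> = (SUP v. (ereal (w \<bullet> L v) - h v) + ereal (- (w \<bullet> b)))"
    \<comment> \<open>The shift is a finite constant, so it commutes with the supremum.\<close>
    by (rule SUP_ereal_add_left[symmetric]) auto
  also have "\<dots> = (SUP v. ereal (w \<bullet> (L v - b)) - h v)"
  proof (rule SUP_cong)
    fix v show "(ereal (w \<bullet> L v) - h v) + ereal (- (w \<bullet> b)) = ereal (w \<bullet> (L v - b)) - h v"
      by (cases "h v") (auto simp: inner_diff_right)
  qed simp
  finally show ?thesis .
qed

text \<open>The epigraph of a supremum is an intersection. Each member is a closed half-space if
  \<open>h v\<close> is finite, everything if \<open>h v = \<infinity>\<close>, and empty if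
  \<open>h v = -\<infinity>\<close>.\<close>

lemma epigraph_dual_g:
  fixes L :: "'c::{real_inner, complete_space} \<Rightarrow> 'g::real_inner"
  assumes "bounded_linear L"
  shows closed_epigraph_dual_g: "closed (ereal_epigraph (dual_g h L b))"
    and convex_epigraph_dual_g: "convex (ereal_epigraph (dual_g h L b))"
proof -
  have eq: "ereal_epigraph (dual_g h L b) =
      (\<Inter>v. {e. ereal (fst e \<bullet> (L v - b)) - h v \<le> ereal (snd e)})"
    by (auto simp: ereal_epigraph_def dual_g_eq_SUP[OF assms] SUP_le_iff)
  have "closed {e. ereal (fst e \<bullet> (L v - b)) - h v \<le> ereal (snd e)}
      \<and> convex {e. ereal (fst e \<bullet> (L v - b)) - h v \<le> ereal (snd e)}" for v
  proof (cases "h v")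
    case (real c)
    have "closed {e::'g \<times> real. fst e \<bullet> (L v - b) - c \<le> snd e}"
      by (intro closed_Collect_le continuous_intros)
    moreover have "convex {e::'g \<times> real. fst e \<bullet> (L v - b) - c \<le> snd e}"
    proof (rule convexI)
      fix e e' :: "'g \<times> real" and i j :: real
      assume e: "e \<in> {e. fst e \<bullet> (L v - b) - c \<le> snd e}" "e' \<in> {e. fst e \<bullet> (L v - b) - c \<le> snd e}"
        and ij: "0 \<le> i" "0 \<le> j" "i + j = 1"
      then have "i * (fst e \<bullet> (L v - b) - c) + j * (fst e' \<bullet> (L v - b) - c) \<le> i * snd e + j * snd e'"
        by (intro add_mono mult_left_mono) auto
      moreover have "i * c + j * c = c"
        using ij by (metis distrib_right mult_1)
      ultimately show "i *\<^sub>R e + j *\<^sub>R e' \<in> {e. fst e \<bullet> (L v - b) - c \<le> snd e}"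
        by (simp add: inner_add_left right_diff_distrib)
    qed
    ultimately show ?thesis
      by (simp add: real)
  qed auto
  then show "closed (ereal_epigraph (dual_g h L b))" "convex (ereal_epigraph (dual_g h L b))"
    unfolding eq by (auto intro!: closed_INT convex_INT)
qed

section \<open>From minimizers of the subproblems to dual subgradients\<close>

text \<open>Optimality of \<open>p\<close> says that the adjoint of \<open>L\<close>, applied to the
  shifted multiplier, is a subgradient of \<open>h\<close> at \<open>p\<close>. Hence
  \<open>p\<close> attains the supremum defining the dual there, and using \<open>p\<close> as a
  competitor at any other point yields the subgradient inequality.\<close>

lemma
  fixes h :: "'c::{real_inner, complete_space} \<Rightarrow> ereal" and L :: "'c \<Rightarrow> 'g::real_inner"
  assumes h: "closed_proper_convex h" and L: "bounded_linear L"
    and min: "is_arg_min (\<lambda>v. h v + ereal (c - w \<bullet> L v + \<gamma> / 2 * (norm (L v + d))\<^sup>2)) (\<lambda>_. True) p"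
  shows minimizer_finite: "\<bar>h p\<bar> \<noteq> \<infinity>"
    and minimizer_dual_subgradient:
      "L p - b \<in> subdifferential (dual_g h L b) (w - \<gamma> *\<^sub>R (L p + d))"
proof -
  interpret L: bounded_linear L by fact
  define q where "q = (\<lambda>v. c - w \<bullet> L v + \<gamma> / 2 * (norm (L v + d))\<^sup>2)"
  \<comment> \<open>Chosen so that \<open>q\<close> has derivative
    \<open>- (w' \<bullet> L (v - p))\<close> at \<open>p\<close> in direction
    \<open>v - p\<close>.\<close>
  define w' where "w' = w - \<gamma> *\<^sub>R (L p + d)"
  have ninf: "h v \<noteq> - \<infinity>" for v
    using h by (simp add: closed_proper_convex_def)
  obtain v0 where v0: "h v0 \<noteq> \<infinity>"
    using h by (auto simp: closed_proper_convex_def)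
  have min': "h p + ereal (q p) \<le> h v + ereal (q v)" for v
    using min by (simp add: is_arg_min_linorder q_def)
  show fin: "\<bar>h p\<bar> \<noteq> \<infinity>"
    using min'[of v0] v0 ninf[of p] by auto
  then obtain s where s: "h p = ereal s"
    by auto
  have opt: "s \<le> r + - (w' \<bullet> L (v - p))" if "h v \<le> ereal r" for v r
  proof (rule convex_first_order_optimality)
    show "convex (ereal_epigraph h)"
      using h by (simp add: closed_proper_convex_def)
    show "(p, s) \<in> ereal_epigraph h" "(v, r) \<in> ereal_epigraph h"
      using that by (simp_all add: ereal_epigraph_def s)
    show "s + q p \<le> t + q u" if "(u, t) \<in> ereal_epigraph h" for u t
    proof -
      have "ereal s + ereal (q p) \<le> h u + ereal (q u)"
        using min' s by metis
      also have "\<dots> \<le> ereal t + ereal (q u)"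
        using that by (intro add_right_mono) (simp add: ereal_epigraph_def)
      finally show ?thesis by simp
    qed
    show "q (p + t *\<^sub>R (v - p)) \<le> q p + t * - (w' \<bullet> L (v - p)) + t\<^sup>2 * (\<gamma> / 2 * (norm (L (v - p)))\<^sup>2)"
      for t
    proof -
      define D a where "D = L (v - p)" and "a = L p + d"
      have Lt: "L (p + t *\<^sub>R (v - p)) = L p + t *\<^sub>R D"
        by (simp add: L.add L.scaleR D_def)
      have "(norm (L (p + t *\<^sub>R (v - p)) + d))\<^sup>2 = (norm (a + t *\<^sub>R D))\<^sup>2"
        by (simp only: Lt a_def ac_simps)
      also have "\<dots> = (norm a)\<^sup>2 + 2 * t * (a \<bullet> D) + t\<^sup>2 * (norm D)\<^sup>2"
        unfolding power2_norm_eq_inner by (simp add: algebra_simps inner_commute power2_eq_square)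
      finally show ?thesis
        unfolding q_def Lt w'_def D_def[symmetric] a_def[symmetric]
        by (simp add: algebra_simps)
    qed
  qed
  have le: "ereal (w' \<bullet> (L v - b)) - h v \<le> ereal (w' \<bullet> (L p - b) - s)" for v
  proof (cases "h v")
    case (real r)
    with opt[of v r] show ?thesis
      by (simp add: L.diff algebra_simps)
  qed (use ninf[of v] in auto)
  have val: "dual_g h L b w' = ereal (w' \<bullet> (L p - b) - s)"
    unfolding dual_g_eq_SUP[OF L]
  proof (rule antisym)
    show "(SUP v. ereal (w' \<bullet> (L v - b)) - h v) \<le> ereal (w' \<bullet> (L p - b) - s)"
      by (rule SUP_least) (rule le)
    show "ereal (w' \<bullet> (L p - b) - s) \<le> (SUP v. ereal (w' \<bullet> (L v - b)) - h v)"
      by (rule SUP_upper2[of p]) (simp_all add: s)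
  qed
  have "dual_g h L b w' + ereal ((L p - b) \<bullet> (u - w')) \<le> dual_g h L b u" for u
  proof -
    have "dual_g h L b w' + ereal ((L p - b) \<bullet> (u - w')) = ereal (u \<bullet> (L p - b)) - h p"
      by (simp add: val s inner_diff_right inner_diff_left inner_commute)
    also have "\<dots> \<le> dual_g h L b u"
      unfolding dual_g_eq_SUP[OF L] by (rule SUP_upper) simp
    finally show ?thesis .
  qed
  then show "L p - b \<in> subdifferential (dual_g h L b) w'"
    by (simp add: subdifferential_def val)
qed

section \<open>Proximal maps and their reflections\<close>

text \<open>Expanding \<open>(norm (v - w))\<^sup>2\<close> around \<open>p\<close> and adding the
  subgradient inequality leaves a gap of at least
  \<open>(norm (v - p))\<^sup>2 / (2 * \<gamma>)\<close>. So \<open>p\<close> is the strict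
  minimizer, and the choice in \<open>arg_min\<close> must return it.\<close>

lemma prox_eqI:
  fixes h :: "'a::real_inner \<Rightarrow> ereal"
  assumes "\<gamma> > 0" and sub: "(1 / \<gamma>) *\<^sub>R (w - p) \<in> subdifferential h p"
  shows "prox \<gamma> h w = p"
proof -
  have fin: "\<bar>h p\<bar> \<noteq> \<infinity>"
    and ge: "\<And>v. h p + ereal ((1 / \<gamma>) *\<^sub>R (w - p) \<bullet> (v - p)) \<le> h v"
    using sub by (auto simp: subdifferential_def split: if_splits)
  obtain s where s: "h p = ereal s"
    using fin by auto
  let ?F = "\<lambda>v. h v + ereal (1 / (2 * \<gamma>) * (norm (v - w))\<^sup>2)"
  have strict: "?F p < ?F v" if "v \<noteq> p" for v
  proof (cases "h v")
    case (real r)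
    have "(norm (v - w))\<^sup>2 = (norm (p - w))\<^sup>2 - 2 * ((w - p) \<bullet> (v - p)) + (norm (v - p))\<^sup>2"
      unfolding power2_norm_eq_inner by (simp add: algebra_simps inner_commute)
    then have "1 / (2 * \<gamma>) * (norm (v - w))\<^sup>2 =
        1 / (2 * \<gamma>) * (norm (p - w))\<^sup>2 - 1 / \<gamma> * ((w - p) \<bullet> (v - p)) + 1 / (2 * \<gamma>) * (norm (v - p))\<^sup>2"
      using \<open>\<gamma> > 0\<close> by (simp add: field_simps)
    moreover have "1 / (2 * \<gamma>) * (norm (v - p))\<^sup>2 > 0"
      using that \<open>\<gamma> > 0\<close> by simp
    moreover have "s + 1 / \<gamma> * ((w - p) \<bullet> (v - p)) \<le> r"
      using ge[of v] by (simp add: s real)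
    ultimately have "s + 1 / (2 * \<gamma>) * (norm (p - w))\<^sup>2 < r + 1 / (2 * \<gamma>) * (norm (v - w))\<^sup>2"
      by linarith
    then show ?thesis
      by (simp add: s real)
  qed (use ge[of v] s in auto)
  have "is_arg_min ?F (\<lambda>_. True) p"
    unfolding is_arg_min_def using strict by (metis order_less_asym)
  then have "is_arg_min ?F (\<lambda>_. True) (arg_min ?F (\<lambda>_. True))"
    unfolding arg_min_def by (rule someI)
  then show ?thesis
    unfolding prox_def is_arg_min_def using strict by blast
qed

text \<open>One subgradient gives an affine minorant, which bounds the proximal objective below. A
  proximal point then exists, and its variational inequality is the subgradient inclusion by which
  \<open>prox_eqI\<close> identifies it with \<open>prox\<close>.\<close>

lemma prox_subgradient:
  fixes h :: "'a::{real_inner, complete_space} \<Rightarrow> ereal"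
  assumes h: "closed (ereal_epigraph h)" "convex (ereal_epigraph h)"
    and u: "u \<in> subdifferential h v0" and "\<gamma> > 0"
  shows "(1 / \<gamma>) *\<^sub>R (w - prox \<gamma> h w) \<in> subdifferential h (prox \<gamma> h w)"
proof -
  obtain s0 where s0: "h v0 = ereal s0"
    and minorant: "\<And>v. ereal (s0 + u \<bullet> (v - v0)) \<le> h v"
    using u by (cases "h v0") (auto simp: subdifferential_def)
  \<comment> \<open>The left side is the minimum over \<open>v\<close> of minorant plus penalty,
    attained at \<open>w - \<gamma> *\<^sub>R u\<close>.\<close>
  have bdd: "s0 + u \<bullet> (w - v0) - \<gamma> * (norm u)\<^sup>2 / 2 \<le> r + (norm (v - w))\<^sup>2 / (2 * \<gamma>)"
    if "(v, r) \<in> ereal_epigraph h" for v r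
  proof -
    have "ereal (s0 + u \<bullet> (v - v0)) \<le> ereal r"
      using order_trans[OF minorant[of v], of "ereal r"] that by (simp add: ereal_epigraph_def)
    moreover have "0 \<le> (norm (v - w + \<gamma> *\<^sub>R u))\<^sup>2 / (2 * \<gamma>)"
      using \<open>\<gamma> > 0\<close> by simp
    moreover have "(norm (a + \<gamma> *\<^sub>R u))\<^sup>2 / (2 * \<gamma>)
        = (norm a)\<^sup>2 / (2 * \<gamma>) + u \<bullet> a + \<gamma> * (norm u)\<^sup>2 / 2" for a
    proof -
      have "(norm (a + \<gamma> *\<^sub>R u))\<^sup>2 = (norm a)\<^sup>2 + 2 * \<gamma> * (u \<bullet> a) + \<gamma>\<^sup>2 * (norm u)\<^sup>2"
        unfolding power2_norm_eq_inner
        by (simp add: inner_commute inner_add_right inner_add_left power2_eq_square)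
      then show ?thesis
        using \<open>\<gamma> > 0\<close> by (simp add: field_simps power2_eq_square)
    qed
    ultimately show ?thesis
      by (simp add: inner_diff_right)
  qed
  obtain p s where p: "(p, s) \<in> ereal_epigraph h"
    and opt: "\<And>v r. (v, r) \<in> ereal_epigraph h \<Longrightarrow> s + ((w - p) \<bullet> (v - p)) / \<gamma> \<le> r"
    using proximal_point_exists[OF h _ \<open>\<gamma> > 0\<close> bdd] s0
    by (metis (mono_tags) case_prodI empty_iff ereal_epigraph_def mem_Collect_eq order_refl)
  obtain sp where sp: "h p = ereal sp"
    using p minorant[of p] by (cases "h p") (auto simp: ereal_epigraph_def)
  \<comment> \<open>A point of the epigraph may lie above the graph; the variational inequality at
    \<open>v = p\<close> excludes this.\<close>
  have "sp = s"
    using opt[of p sp] p by (auto simp: ereal_epigraph_def sp)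
  have "h p + ereal ((1 / \<gamma>) *\<^sub>R (w - p) \<bullet> (v - p)) \<le> h v" for v
  proof (cases "h v")
    case (real r)
    with opt[of v r] show ?thesis
      by (simp add: ereal_epigraph_def sp \<open>sp = s\<close>)
  qed (use minorant[of v] in auto)
  then have "(1 / \<gamma>) *\<^sub>R (w - p) \<in> subdifferential h p"
    by (simp add: subdifferential_def sp)
  with prox_eqI[OF \<open>\<gamma> > 0\<close> this] show ?thesis
    by simp
qed

lemma subdifferential_monotone:
  assumes "u \<in> subdifferential h p" "u' \<in> subdifferential h p'"
  shows "(u - u') \<bullet> (p - p') \<ge> 0"
proof -
  have "\<bar>h p\<bar> \<noteq> \<infinity>" "\<bar>h p'\<bar> \<noteq> \<infinity>"
    and "h p + ereal (u \<bullet> (p' - p)) \<le> h p'" "h p' + ereal (u' \<bullet> (p - p')) \<le> h p"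
    using assms by (auto simp: subdifferential_def split: if_splits)
  then show ?thesis
    by (cases "h p"; cases "h p'") (auto simp: inner_diff_left inner_diff_right)
qed

text \<open>Monotonicity of the subdifferential at the two proximal points is firm nonexpansiveness,
  \<open>(v - w - d) \<bullet> d \<ge> 0\<close>; reflecting subtracts exactly four times this term
  from \<open>(norm (v - w))\<^sup>2\<close>.\<close>

lemma reflected_prox_nonexpansive:
  fixes h :: "'a::{real_inner, complete_space} \<Rightarrow> ereal"
  assumes h: "closed (ereal_epigraph h)" "convex (ereal_epigraph h)"
    and u: "u \<in> subdifferential h v0" and "\<gamma> > 0"
  shows "norm (reflected_prox \<gamma> h v - reflected_prox \<gamma> h w) \<le> norm (v - w)"
proof -
  define d where "d = prox \<gamma> h v - prox \<gamma> h w"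
  have "((1 / \<gamma>) *\<^sub>R (v - prox \<gamma> h v) - (1 / \<gamma>) *\<^sub>R (w - prox \<gamma> h w)) \<bullet> d \<ge> 0"
    unfolding d_def by (intro subdifferential_monotone[of _ h] prox_subgradient[OF assms])
  also have "((1 / \<gamma>) *\<^sub>R (v - prox \<gamma> h v) - (1 / \<gamma>) *\<^sub>R (w - prox \<gamma> h w)) \<bullet> d
      = (1 / \<gamma>) * ((v - w - d) \<bullet> d)"
    by (simp add: d_def algebra_simps)
  finally have firm: "(v - w - d) \<bullet> d \<ge> 0"
    using \<open>\<gamma> > 0\<close> by (simp add: zero_le_mult_iff zero_le_divide_iff)
  have "reflected_prox \<gamma> h v - reflected_prox \<gamma> h w = 2 *\<^sub>R d - (v - w)"
    by (simp add: reflected_prox_def d_def algebra_simps)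
  moreover have "(norm (2 *\<^sub>R d - (v - w)))\<^sup>2 = (norm (v - w))\<^sup>2 - 4 * ((v - w - d) \<bullet> d)"
    unfolding power2_norm_eq_inner by (simp add: algebra_simps inner_commute)
  ultimately have "(norm (reflected_prox \<gamma> h v - reflected_prox \<gamma> h w))\<^sup>2 \<le> (norm (v - w))\<^sup>2"
    using firm by simp
  then show ?thesis
    by (rule power2_le_imp_le) simp
qed

section \<open>Residuals of relaxed nonexpansive iterations\<close>

text \<open>At least \<open>(n + 1) / 2\<close> terms have index between \<open>n div 2\<close> and
  \<open>n\<close>, each no smaller than \<open>a n\<close>. Their sum tends to 0 as a difference of
  partial sums with the same limit.\<close>

lemma decseq_summable_imp_mult_tendsto_zero:
  fixes a :: "nat \<Rightarrow> real"
  assumes dec: "decseq a" and nn: "\<And>n. 0 \<le> a n" and sum: "summable a"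
  shows "(\<lambda>n. real (n + 1) * a n) \<longlonglongrightarrow> 0"
proof -
  define S where "S = (\<lambda>n. \<Sum>i<n. a i)"
  have S: "S \<longlonglongrightarrow> suminf a"
    unfolding S_def using sum by (rule summable_LIMSEQ)
  have half: "filterlim (\<lambda>n::nat. n div 2) sequentially sequentially"
    by (rule filterlim_at_top_div_const_nat) simp
  have "(\<lambda>n. 2 * (S (Suc n) - S (n div 2))) \<longlonglongrightarrow> 2 * (suminf a - suminf a)"
    by (intro tendsto_intros LIMSEQ_Suc[OF S] filterlim_compose[OF S half])
  then have lim: "(\<lambda>n. 2 * (S (Suc n) - S (n div 2))) \<longlonglongrightarrow> 0"
    by simp
  show ?thesis
  proof (rule tendsto_sandwich[OF _ _ tendsto_const lim])
    show "\<forall>\<^sub>F n in sequentially. 0 \<le> real (n + 1) * a n"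
      using nn by (intro always_eventually allI mult_nonneg_nonneg) auto
    show "\<forall>\<^sub>F n in sequentially. real (n + 1) * a n \<le> 2 * (S (Suc n) - S (n div 2))"
    proof (intro always_eventually allI)
      fix n :: nat
      have "real (n + 1) \<le> 2 * real (Suc n - n div 2)"
        by linarith
      then have "real (n + 1) * a n \<le> 2 * (real (Suc n - n div 2) * a n)"
        using nn[of n] by (metis mult.assoc mult_right_mono)
      also have "real (Suc n - n div 2) * a n = (\<Sum>i = n div 2..<Suc n. a n)"
        by simp
      also have "\<dots> \<le> (\<Sum>i = n div 2..<Suc n. a i)"
        by (intro sum_mono decseqD[OF dec]) auto
      also have "\<dots> = S (Suc n) - S (n div 2)"
        unfolding S_def lessThan_atLeast0 by (rule sum_diff_nat_ivl[symmetric]) auto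
      finally show "real (n + 1) * a n \<le> 2 * (S (Suc n) - S (n div 2))"
        by simp
    qed
  qed
qed

text \<open>The squared norm of a convex combination equals the combination of squares minus
  \<open>l * (1 - l)\<close> times the squared difference; nonexpansiveness towards the fixed point
  gives \<open>norm v \<le> norm u\<close>.\<close>

lemma relaxed_PRS_fejer:
  fixes T :: "'g::real_inner \<Rightarrow> 'g"
  assumes z: "relaxed_PRS T lam z0 z"
    and nonexp: "\<And>u v. norm (T u - T v) \<le> norm (u - v)"
    and fixp: "T p = p" and lam: "\<And>j. 0 \<le> lam j \<and> lam j \<le> 1"
  shows "(norm (z (Suc k) - p))\<^sup>2
    \<le> (norm (z k - p))\<^sup>2 - lam k * (1 - lam k) * (norm (T (z k) - z k))\<^sup>2"
proof -
  define l u v where "l = lam k" and "u = z k - p" and "v = T (z k) - p"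
  have "z (Suc k) - p = (1 - l) *\<^sub>R u + l *\<^sub>R v"
    using z by (simp add: relaxed_PRS_def l_def u_def v_def algebra_simps)
  moreover have "T (z k) - z k = v - u"
    by (simp add: u_def v_def)
  moreover have "(norm ((1 - l) *\<^sub>R u + l *\<^sub>R v))\<^sup>2
      = (1 - l) * (norm u)\<^sup>2 + l * (norm v)\<^sup>2 - l * (1 - l) * (norm (v - u))\<^sup>2"
    unfolding power2_norm_eq_inner by (simp add: algebra_simps inner_commute power2_eq_square)
  moreover have "l * (norm v)\<^sup>2 \<le> l * (norm u)\<^sup>2"
    using nonexp[of "z k" p] lam[of k]
    by (intro mult_left_mono power_mono) (auto simp: u_def v_def l_def fixp)
  moreover have "(1 - l) * (norm u)\<^sup>2 + l * (norm u)\<^sup>2 = (norm u)\<^sup>2"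
    by (simp add: algebra_simps)
  ultimately show ?thesis
    unfolding u_def[symmetric] l_def[symmetric] by simp
qed

text \<open>The new residual is \<open>T (z (Suc k)) - T (z k)\<close> plus \<open>1 - l\<close>
  times the old one, and the first part is no longer than the step, which is \<open>l\<close> times
  the old residual.\<close>

lemma relaxed_PRS_residual_antimono:
  fixes T :: "'g::real_inner \<Rightarrow> 'g"
  assumes z: "relaxed_PRS T lam z0 z"
    and nonexp: "\<And>u v. norm (T u - T v) \<le> norm (u - v)"
    and lam: "\<And>j. 0 \<le> lam j \<and> lam j \<le> 1"
  shows "norm (T (z (Suc k)) - z (Suc k)) \<le> norm (T (z k) - z k)"
proof -
  define l s where "l = lam k" and "s = T (z k) - z k"
  have step: "z (Suc k) = (1 - l) *\<^sub>R z k + l *\<^sub>R T (z k)"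
    using z by (simp add: relaxed_PRS_def l_def)
  have "T (z (Suc k)) - z (Suc k) = (T (z (Suc k)) - T (z k)) + (1 - l) *\<^sub>R s"
    by (simp add: step s_def algebra_simps)
  then have "norm (T (z (Suc k)) - z (Suc k)) \<le> norm (T (z (Suc k)) - T (z k)) + norm ((1 - l) *\<^sub>R s)"
    by (simp only: norm_triangle_ineq)
  also have "norm (T (z (Suc k)) - T (z k)) \<le> norm (z (Suc k) - z k)"
    by (rule nonexp)
  also have "z (Suc k) - z k = l *\<^sub>R s"
    by (simp add: step s_def algebra_simps)
  finally have "norm (T (z (Suc k)) - z (Suc k)) \<le> l * norm s + (1 - l) * norm s"
    using lam[of k] by (simp add: l_def)
  then show ?thesis
    by (simp add: s_def algebra_simps)
qed

text \<open>Summing the Fejer inequality bounds \<open>\<tau>\<close> times the sum of squared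
  residuals; their monotonicity turns this into both rates.\<close>

lemma relaxed_PRS_residual_rate:
  fixes T :: "'g::real_inner \<Rightarrow> 'g"
  assumes z: "relaxed_PRS T lam z0 z"
    and nonexp: "\<And>u v. norm (T u - T v) \<le> norm (u - v)"
    and fixp: "T p = p" and lam: "\<And>j. 0 \<le> lam j \<and> lam j \<le> 1"
    and \<tau>: "0 < \<tau>" "\<And>j. \<tau> \<le> lam j * (1 - lam j)"
  shows "(norm (T (z k) - z k))\<^sup>2 \<le> (norm (z 0 - p))\<^sup>2 / (\<tau> * real (k + 1))"
    and "(\<lambda>k. real (k + 1) * (norm (T (z k) - z k))\<^sup>2) \<longlonglongrightarrow> 0"
proof -
  define a where "a = (\<lambda>k. (norm (T (z k) - z k))\<^sup>2)"
  have dec: "decseq a"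
    unfolding a_def
    by (intro decseq_SucI power_mono relaxed_PRS_residual_antimono[OF z nonexp lam]) auto
  have tele: "\<tau> * (\<Sum>i<n. a i) + (norm (z n - p))\<^sup>2 \<le> (norm (z 0 - p))\<^sup>2" for n
  proof (induction n)
    case (Suc n)
    have "\<tau> * a n \<le> lam n * (1 - lam n) * a n"
      using \<tau>(2) by (intro mult_right_mono) (auto simp: a_def)
    with Suc relaxed_PRS_fejer[OF z nonexp fixp lam, of n] show ?case
      by (simp add: a_def algebra_simps)
  qed simp
  have bound: "(\<Sum>i<n. a i) \<le> (norm (z 0 - p))\<^sup>2 / \<tau>" for n
  proof -
    have "\<tau> * (\<Sum>i<n. a i) \<le> (norm (z 0 - p))\<^sup>2"
      using tele[of n] zero_le_power2[of "norm (z n - p)"] by linarith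
    then show ?thesis
      using \<tau>(1) by (simp add: pos_le_divide_eq mult.commute)
  qed
  have "real (k + 1) * a k = (\<Sum>i<Suc k. a k)"
    by simp
  also have "\<dots> \<le> (\<Sum>i<Suc k. a i)"
    by (intro sum_mono decseqD[OF dec]) auto
  also have "\<dots> \<le> (norm (z 0 - p))\<^sup>2 / \<tau>"
    by (rule bound)
  finally show "(norm (T (z k) - z k))\<^sup>2 \<le> (norm (z 0 - p))\<^sup>2 / (\<tau> * real (k + 1))"
    using \<tau>(1) by (simp add: a_def pos_le_divide_eq mult.assoc mult.left_commute mult.commute del: of_nat_Suc of_nat_add)
  have "summable a"
    by (rule bounded_imp_summable[where B = "(norm (z 0 - p))\<^sup>2 / \<tau>"])
      (simp_all add: a_def bound[unfolded a_def] lessThan_Suc_atMost[symmetric] del: sum.lessThan_Suc)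
  from decseq_summable_imp_mult_tendsto_zero[OF dec _ this]
  show "(\<lambda>k. real (k + 1) * (norm (T (z k) - z k))\<^sup>2) \<longlonglongrightarrow> 0"
    by (simp add: a_def)
qed

lemma relaxed_PRS_bounded:
  fixes T :: "'g::real_inner \<Rightarrow> 'g"
  assumes z: "relaxed_PRS T lam z0 z"
    and nonexp: "\<And>u v. norm (T u - T v) \<le> norm (u - v)"
    and fixp: "T p = p" and lam: "\<And>j. 0 \<le> lam j \<and> lam j \<le> 1"
  shows "norm (z k - p) \<le> norm (z 0 - p)"
proof (induction k)
  case (Suc k)
  have "0 \<le> lam k * (1 - lam k) * (norm (T (z k) - z k))\<^sup>2"
    using lam[of k] by simp
  then have "(norm (z (Suc k) - p))\<^sup>2 \<le> (norm (z k - p))\<^sup>2"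
    using relaxed_PRS_fejer[OF z nonexp fixp lam, of k] by linarith
  then have "norm (z (Suc k) - p) \<le> norm (z k - p)"
    by (rule power2_le_imp_le) simp
  with Suc show ?case by simp
qed simp

section \<open>Relaxed ADMM as Peaceman-Rachford splitting on the dual\<close>

lemma relaxed_admm_step_subgradients:
  fixes f :: "'a::{real_inner, complete_space} \<Rightarrow> ereal"
    and g :: "'c::{real_inner, complete_space} \<Rightarrow> ereal"
    and A :: "'a \<Rightarrow> 'g::real_inner" and B :: "'c \<Rightarrow> 'g"
  assumes f: "closed_proper_convex f" and g: "closed_proper_convex g"
    and A: "bounded_linear A" and B: "bounded_linear B"
    and step: "relaxed_admm_step f g A B b \<gamma> l (x, y, w) (x', y', w')"
  shows "B y' - b \<in> subdifferential (dual_g g B b) w'"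
    and "A x' \<in> subdifferential (dual_f f A) (w' - \<gamma> *\<^sub>R (A x' + B y' - b))"
    and "w' = w - \<gamma> *\<^sub>R (A x + B y' - b) - (\<gamma> * (2 * l - 1)) *\<^sub>R (A x + B y - b)"
proof -
  define r where "r = A x + B y - b"
  show w': "w' = w - \<gamma> *\<^sub>R (A x + B y' - b) - (\<gamma> * (2 * l - 1)) *\<^sub>R (A x + B y - b)"
    using step by (simp add: relaxed_admm_step_def)
  \<comment> \<open>The relaxation term is linear in \<open>B v\<close>, so it only shifts the
    multiplier \<open>w\<close> by \<open>- (\<gamma> * (2 * l - 1)) *\<^sub>R r\<close>.\<close>
  have obj_y: "(\<lambda>v. aug_lagrangian (\<lambda>_. 0) g A B b \<gamma> x v w + ereal (\<gamma> * (2 * l - 1) * (B v \<bullet> r)))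
      = (\<lambda>v. g v + ereal (- (w \<bullet> (A x - b)) - (w - (\<gamma> * (2 * l - 1)) *\<^sub>R r) \<bullet> B v
                          + \<gamma> / 2 * (norm (B v + (A x - b)))\<^sup>2))"
  proof
    fix v
    have eq: "A x + B v - b = B v + (A x - b)"
      by simp
    show "aug_lagrangian (\<lambda>_. 0) g A B b \<gamma> x v w + ereal (\<gamma> * (2 * l - 1) * (B v \<bullet> r))
      = g v + ereal (- (w \<bullet> (A x - b)) - (w - (\<gamma> * (2 * l - 1)) *\<^sub>R r) \<bullet> B v
                     + \<gamma> / 2 * (norm (B v + (A x - b)))\<^sup>2)"
      unfolding aug_lagrangian_def eq
      by (cases "g v") (simp_all add: inner_diff_left inner_diff_right inner_add_right inner_commute)
  qed
  have min_y: "is_arg_min (\<lambda>v. g v + ereal (- (w \<bullet> (A x - b)) - (w - (\<gamma> * (2 * l - 1)) *\<^sub>R r) \<bullet> B v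
                          + \<gamma> / 2 * (norm (B v + (A x - b)))\<^sup>2)) (\<lambda>_. True) y'"
    using step by (simp only: relaxed_admm_step_def prod.case obj_y[unfolded r_def] r_def)
  \<comment> \<open>The multiplier update lands exactly on the point where the optimality condition
    of \<open>y'\<close> yields its subgradient.\<close>
  have "w' = (w - (\<gamma> * (2 * l - 1)) *\<^sub>R r) - \<gamma> *\<^sub>R (B y' + (A x - b))"
    by (simp add: w' r_def algebra_simps)
  with minimizer_dual_subgradient[OF g B min_y]
  show "B y' - b \<in> subdifferential (dual_g g B b) w'"
    by simp
  \<comment> \<open>Finiteness lets \<open>g y'\<close> join the real constant of the
    \<open>x\<close>-objective.\<close>
  obtain s where s: "g y' = ereal s"
    using minimizer_finite[OF g B min_y] by auto
  have obj_x: "(\<lambda>u. aug_lagrangian f g A B b \<gamma> u y' w')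
      = (\<lambda>u. f u + ereal ((s - w' \<bullet> (B y' - b)) - w' \<bullet> A u + \<gamma> / 2 * (norm (A u + (B y' - b)))\<^sup>2))"
  proof
    fix u
    have eq: "A u + B y' - b = A u + (B y' - b)"
      by simp
    show "aug_lagrangian f g A B b \<gamma> u y' w'
      = f u + ereal ((s - w' \<bullet> (B y' - b)) - w' \<bullet> A u + \<gamma> / 2 * (norm (A u + (B y' - b)))\<^sup>2)"
      unfolding aug_lagrangian_def s eq by (cases "f u") (simp_all add: inner_add_right)
  qed
  have "is_arg_min (\<lambda>u. f u + ereal ((s - w' \<bullet> (B y' - b)) - w' \<bullet> A u
                          + \<gamma> / 2 * (norm (A u + (B y' - b)))\<^sup>2)) (\<lambda>_. True) x'"
    using step unfolding relaxed_admm_step_def prod.case obj_x by blast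
  from minimizer_dual_subgradient[OF f A this, of 0]
  show "A x' \<in> subdifferential (dual_f f A) (w' - \<gamma> *\<^sub>R (A x' + B y' - b))"
    by (simp add: dual_f_eq_dual_g add_diff_eq)
qed

text \<open>The two inclusions identify the proximal points as \<open>w\<close> and
  \<open>w - \<gamma> *\<^sub>R (u + v)\<close>, with the intermediate reflection
  \<open>w - \<gamma> *\<^sub>R v\<close>.\<close>

lemma T_PRS_of_subgradients:
  fixes df dg :: "'g::real_inner \<Rightarrow> ereal"
  assumes "\<gamma> > 0" and dg: "v \<in> subdifferential dg w"
    and df: "u \<in> subdifferential df (w - \<gamma> *\<^sub>R (u + v))"
  shows "T_PRS \<gamma> df dg (w + \<gamma> *\<^sub>R v) = w + \<gamma> *\<^sub>R v - (2 * \<gamma>) *\<^sub>R (u + v)"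
proof -
  have "(1 / \<gamma>) *\<^sub>R (w + \<gamma> *\<^sub>R v - w) = v"
    using \<open>\<gamma> > 0\<close> by simp
  then have "prox \<gamma> dg (w + \<gamma> *\<^sub>R v) = w"
    using dg \<open>\<gamma> > 0\<close> by (intro prox_eqI) simp_all
  then have refl: "reflected_prox \<gamma> dg (w + \<gamma> *\<^sub>R v) = w - \<gamma> *\<^sub>R v"
    by (simp add: reflected_prox_def scaleR_2)
  have "(1 / \<gamma>) *\<^sub>R (w - \<gamma> *\<^sub>R v - (w - \<gamma> *\<^sub>R (u + v))) = u"
    using \<open>\<gamma> > 0\<close> by (simp add: algebra_simps)
  then have prox_df: "prox \<gamma> df (w - \<gamma> *\<^sub>R v) = w - \<gamma> *\<^sub>R (u + v)"
    using df \<open>\<gamma> > 0\<close> by (intro prox_eqI) simp_all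
  show ?thesis
    unfolding T_PRS_def comp_apply refl unfolding reflected_prox_def prox_df
    by (simp only: scaleR_2 mult_2 scaleR_add_left scaleR_add_right) simp
qed

section \<open>Convergence rates of the feasibility gap\<close>

theorem theorem13:
  fixes f :: "'a::{real_inner, complete_space} \<Rightarrow> ereal"
    and g :: "'c::{real_inner, complete_space} \<Rightarrow> ereal"
    and A :: "'a \<Rightarrow> 'g::{real_inner, complete_space}"
    and B :: "'c \<Rightarrow> 'g"
    and b w_init z_star :: 'g
    and \<gamma> :: real
    and lam :: "nat \<Rightarrow> real"
    and x :: "nat \<Rightarrow> 'a" and y :: "nat \<Rightarrow> 'c" and w z :: "nat \<Rightarrow> 'g"
  assumes f: "closed_proper_convex f" and g: "closed_proper_convex g"
    and A: "bounded_linear A" and B: "bounded_linear B"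
    and zer_nonempty:
      "zer (\<lambda>v. subdifferential (dual_f f A) v + subdifferential (dual_g g B b) v) \<noteq> {}"
    and subdiff_dual_f:
      "\<And>v. subdifferential (dual_f f A) v
             = A ` subdifferential (fenchel_conjugate f) (adjoint A v)"
    and subdiff_dual_g:
      "\<And>v. subdifferential (dual_g g B b) v
             = (\<lambda>u. B u - b) ` subdifferential (fenchel_conjugate g) (adjoint B v)"
    and gamma: "\<gamma> > 0"
    and lam: "\<And>j. 0 < lam j \<and> lam j \<le> 1"
    and admm: "relaxed_admm f g A B b \<gamma> lam w_init x y w"
    and prs: "relaxed_PRS (T_PRS \<gamma> (dual_f f A) (dual_g g B b)) lam w_init z"
    and fixpoint: "T_PRS \<gamma> (dual_f f A) (dual_g g B b) z_star = z_star"
  shows "(\<forall>k. (norm (A (ergodic_mean lam x k) + B (ergodic_mean lam y k) - b))\<^sup>2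
                \<le> 4 * (norm (z 0 - z_star))\<^sup>2 / (\<gamma>\<^sup>2 * (weight_sum lam k)\<^sup>2))
       \<and> (let \<tau> = (INF j. lam j * (1 - lam j)) in
            \<tau> > 0 \<longrightarrow>
              (\<forall>k. (norm (A (x k) + B (y k) - b))\<^sup>2
                     \<le> (norm (z 0 - z_star))\<^sup>2 / (4 * \<gamma>\<^sup>2 * \<tau> * real (k + 1)))
            \<and> (\<lambda>k. (norm (A (x k) + B (y k) - b))\<^sup>2) \<in> o(\<lambda>k. 1 / real (k + 1)))"
proof -
  define T where "T = T_PRS \<gamma> (dual_f f A) (dual_g g B b)"
  define r where "r = (\<lambda>k. A (x k) + B (y k) - b)"
  interpret A: bounded_linear A by fact
  interpret B: bounded_linear B by fact

  have step0: "relaxed_admm_step f g A B b \<gamma> (1 / 2) (0, 0, w_init) (x 0, y 0, w 0)"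
    and step: "relaxed_admm_step f g A B b \<gamma> (lam k) (x k, y k, w k) (x (Suc k), y (Suc k), w (Suc k))" for k
    using admm by (simp_all add: relaxed_admm_def)
  note sub0 = relaxed_admm_step_subgradients[OF f g A B step0]
    and sub = relaxed_admm_step_subgradients[OF f g A B step]
  have dg: "B (y k) - b \<in> subdifferential (dual_g g B b) (w k)" for k
    using sub0(1) sub(1) by (cases k) auto
  have df: "A (x k) \<in> subdifferential (dual_f f A) (w k - \<gamma> *\<^sub>R r k)" for k
    using sub0(2) sub(2) unfolding r_def by (cases k) auto

  \<comment> \<open>The subgradients found at index 0 make both proximal maps well defined.\<close>
  have nonexp: "norm (T u - T v) \<le> norm (u - v)" for u v
  proof -
    have "norm (T u - T v) \<le> norm (reflected_prox \<gamma> (dual_g g B b) u - reflected_prox \<gamma> (dual_g g B b) v)"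
      unfolding T_def T_PRS_def comp_def
      by (rule reflected_prox_nonexpansive[OF _ _ df[of 0] gamma])
        (simp_all only: dual_f_eq_dual_g epigraph_dual_g[OF A])
    also have "\<dots> \<le> norm (u - v)"
      by (rule reflected_prox_nonexpansive[OF _ _ dg[of 0] gamma]) (simp_all only: epigraph_dual_g[OF B])
    finally show ?thesis .
  qed

  have T_w: "T (w k + \<gamma> *\<^sub>R (B (y k) - b)) = w k + \<gamma> *\<^sub>R (B (y k) - b) - (2 * \<gamma>) *\<^sub>R r k" for k
    using T_PRS_of_subgradients[OF gamma dg df[unfolded r_def add_diff_eq[symmetric]], of k]
    by (simp add: T_def r_def add_diff_eq)
  have z_Suc: "z (Suc k) = (1 - lam k) *\<^sub>R z k + lam k *\<^sub>R T (z k)" for k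
    using prs by (simp add: relaxed_PRS_def T_def)
  have z_eq: "z k = w k + \<gamma> *\<^sub>R (B (y k) - b)" for k
  proof (induction k)
    case 0
    have "z 0 = w_init"
      using prs by (simp add: relaxed_PRS_def)
    \<comment> \<open>With parameter \<open>1 / 2\<close> and \<open>x = 0\<close> the first update
      reads \<open>w 0 = w_init - \<gamma> *\<^sub>R (B (y 0) - b)\<close>.\<close>
    then show ?case
      using sub0(3) by (simp add: A.zero)
  next
    case (Suc k)
    have "z (Suc k) = z k - (2 * \<gamma> * lam k) *\<^sub>R r k"
      unfolding z_Suc Suc.IH T_w by (simp add: algebra_simps)
    \<comment> \<open>On the right \<open>y (Suc k)\<close> cancels, leaving \<open>w k - \<gamma>
      *\<^sub>R A (x k) - (\<gamma> * (2 * lam k - 1)) *\<^sub>R r k\<close>, where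
      \<open>A (x k) = r k - (B (y k) - b)\<close>.\<close>
    also have "\<dots> = w (Suc k) + \<gamma> *\<^sub>R (B (y (Suc k)) - b)"
      unfolding Suc.IH sub(3)[of k] r_def by (simp add: algebra_simps flip: scaleR_2)
    finally show ?case .
  qed
  have residual: "T (z k) - z k = - (2 * \<gamma>) *\<^sub>R r k" for k
    using T_w[of k] by (simp add: z_eq)
  have norm_r: "(norm (r k))\<^sup>2 = (norm (T (z k) - z k))\<^sup>2 / (4 * \<gamma>\<^sup>2)" for k
    unfolding residual using gamma by (simp add: power_mult_distrib)
  have lam': "0 \<le> lam j \<and> lam j \<le> 1" for j
    using lam[of j] by simp
  note prs' = prs[folded T_def] and fixp = fixpoint[folded T_def]

  have ergodic: "(norm (A (ergodic_mean lam x k) + B (ergodic_mean lam y k) - b))\<^sup>2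
      \<le> 4 * (norm (z 0 - z_star))\<^sup>2 / (\<gamma>\<^sup>2 * (weight_sum lam k)\<^sup>2)" for k
  proof -
    define W where "W = weight_sum lam k"
    have "W > 0"
      unfolding W_def weight_sum_def using lam by (intro sum_pos) auto
    have tele: "z n - z 0 = - (2 * \<gamma>) *\<^sub>R (\<Sum>i<n. lam i *\<^sub>R r i)" for n
    proof (induction n)
      case (Suc n)
      have "z (Suc n) - z n = lam n *\<^sub>R (T (z n) - z n)"
        by (simp add: z_Suc algebra_simps)
      then have "z (Suc n) - z n = - (2 * \<gamma>) *\<^sub>R (lam n *\<^sub>R r n)"
        by (simp add: residual mult.commute)
      moreover have "z (Suc n) - z 0 = (z (Suc n) - z n) + (z n - z 0)"
        by simp
      ultimately show ?case
        unfolding Suc.IH by (simp add: scaleR_add_right del: scaleR_scaleR scaleR_minus_left)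
    qed simp
    define S where "S = (\<Sum>i<Suc k. lam i *\<^sub>R r i)"
    have "A (ergodic_mean lam x k) + B (ergodic_mean lam y k) - b
        = (1 / W) *\<^sub>R (A (\<Sum>i=0..k. lam i *\<^sub>R x i) + B (\<Sum>i=0..k. lam i *\<^sub>R y i) - W *\<^sub>R b)"
      using \<open>W > 0\<close> by (simp add: ergodic_mean_def A.scaleR B.scaleR W_def algebra_simps)
    \<comment> \<open>\<open>W\<close> is the sum of the weights, so \<open>W *\<^sub>R b\<close>
      splits over the sum and each summand becomes a weighted gap.\<close>
    also have "A (\<Sum>i=0..k. lam i *\<^sub>R x i) + B (\<Sum>i=0..k. lam i *\<^sub>R y i) - W *\<^sub>R b = S"
      by (simp add: S_def r_def A.sum B.sum A.scaleR B.scaleR W_def weight_sum_def scaleR_sum_left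
          scaleR_add_right scaleR_diff_right sum.distrib sum_subtractf lessThan_Suc_atMost atMost_atLeast0
          del: sum.lessThan_Suc)
    finally have mean: "A (ergodic_mean lam x k) + B (ergodic_mean lam y k) - b = (1 / W) *\<^sub>R S" .
    have "2 * \<gamma> * norm S = norm (z (Suc k) - z 0)"
      unfolding tele S_def using gamma by simp
    also have "\<dots> \<le> norm (z (Suc k) - z_star) + norm (z 0 - z_star)"
      using norm_triangle_ineq4[of "z (Suc k) - z_star" "z 0 - z_star"] by simp
    also have "\<dots> \<le> 2 * norm (z 0 - z_star)"
      using relaxed_PRS_bounded[OF prs' nonexp fixp lam', of "Suc k"] by simp
    finally have "norm S \<le> norm (z 0 - z_star) / \<gamma>"
      using gamma by (simp add: pos_le_divide_eq mult.commute)
    then have "norm ((1 / W) *\<^sub>R S) \<le> norm (z 0 - z_star) / \<gamma> / W"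
      using \<open>W > 0\<close> divide_right_mono[of "norm S" "norm (z 0 - z_star) / \<gamma>" W] by simp
    then have "(norm ((1 / W) *\<^sub>R S))\<^sup>2 \<le> (norm (z 0 - z_star) / \<gamma> / W)\<^sup>2"
      by (rule power_mono) simp
    also have "\<dots> = (norm (z 0 - z_star))\<^sup>2 / (\<gamma>\<^sup>2 * W\<^sup>2)"
      by (simp add: power_divide power_mult_distrib)
    \<comment> \<open>The estimate so far has constant 1; it is relaxed to the stated 4.\<close>
    also have "\<dots> \<le> 4 * (norm (z 0 - z_star))\<^sup>2 / (\<gamma>\<^sup>2 * W\<^sup>2)"
      by (intro divide_right_mono) auto
    finally show ?thesis
      unfolding mean W_def .
  qed

  define \<tau> where "\<tau> = (INF j. lam j * (1 - lam j))"
  have nonergodic: "(norm (r k))\<^sup>2 \<le> (norm (z 0 - z_star))\<^sup>2 / (4 * \<gamma>\<^sup>2 * \<tau> * real (k + 1))"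
    and little_o: "(\<lambda>k. (norm (r k))\<^sup>2) \<in> o(\<lambda>k. 1 / real (k + 1))" if "\<tau> > 0" for k
  proof -
    \<comment> \<open>A real infimum is a lower bound only of a set bounded below; here 0 is a
      bound.\<close>
    have \<tau>_le: "\<tau> \<le> lam j * (1 - lam j)" for j
      unfolding \<tau>_def using lam' by (intro cINF_lower bdd_belowI2[of _ 0]) auto
    note rate = relaxed_PRS_residual_rate[OF prs' nonexp fixp lam' \<open>\<tau> > 0\<close> \<tau>_le]
    have "(norm (r k))\<^sup>2 \<le> (norm (z 0 - z_star))\<^sup>2 / (\<tau> * real (k + 1)) / (4 * \<gamma>\<^sup>2)"
      unfolding norm_r by (rule divide_right_mono[OF rate(1)]) simp
    then show "(norm (r k))\<^sup>2 \<le> (norm (z 0 - z_star))\<^sup>2 / (4 * \<gamma>\<^sup>2 * \<tau> * real (k + 1))"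
      by (simp add: mult_ac)
    have "(\<lambda>k. real (k + 1) * (norm (T (z k) - z k))\<^sup>2 / (4 * \<gamma>\<^sup>2)) \<longlonglongrightarrow> 0 / (4 * \<gamma>\<^sup>2)"
      using gamma by (intro tendsto_divide tendsto_const rate(2)) simp
    then have "(\<lambda>k. (norm (r k))\<^sup>2 / (1 / real (k + 1))) \<longlonglongrightarrow> 0"
      by (simp add: norm_r mult.commute)
    then show "(\<lambda>k. (norm (r k))\<^sup>2) \<in> o(\<lambda>k. 1 / real (k + 1))"
      by (rule smalloI_tendsto) simp
  qed

  show ?thesis
    unfolding Let_def \<tau>_def[symmetric] using ergodic nonergodic little_o by (simp only: r_def) blast
qed

end
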